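(* Let $l\geqslant 1$. The map $\sigma^{-1}\circ P^{-1}\circ D\circ\sigma$ is a bijection from $\mathcal F_\emptyset$ to $\mathcal F_\emptyset$ which, for every $p$, sends an element $\Phi\in\mathcal F_\emptyset$ such that $\sharp\Phi_{min}=p$ to an element $\Psi\in\mathcal F_\emptyset$ such that $\sharp\Psi_{min}=l-p$.
   Context: Roots. Let $\Delta^+=\{\alpha_{i,j}: 1\leqslant i\leqslant j\leqslant l\}$ be the positive roots of $\mathfrak{sl}_{l+1}(\mathbb C)$, where $\alpha_1,\dots,\alpha_l$ are the simple roots and $\alpha_{i,j}=\alpha_i+\cdots+\alpha_j$. Let $\mathcal F_\emptyset$ be the set of $\Phi\subset\Delta^+$ such that $\alpha\in\Phi$, $\beta\in\Delta^+$, $\alpha+\beta\in\Delta^+$ imply $\alpha+\beta\in\Phi$. For $\Phi\in\mathcal F_\emptyset$, $\Phi_{min}=\{\beta\in\Phi:\beta-\alpha\notin\Phi\text{ for all }\alpha\in\Delta^+\}$. Partitions. An $l$-partition is $\lambda=(\lambda_1,\dots,\lambda_l)\in\mathbb N^l$ with $\lambda_1\geqslant\cdots\geqslant\lambda_l\geqslant 0$ and $\lambda_i\leqslant l+1-i$ for all $i$; put $\lambda_{l+1}=0$. The map $\sigma$ is the bijection from $\mathcal F_\emptyset$ to the set of $l$-partitions given as follows: place the root $\alpha_{i,l+1-j}$ in the cell (row $i$, column $j$) of the Ferrers diagram of $(l,l-1,\dots,1)$; the cells with roots in $\Phi$ form the Ferrers diagram of $\sigma(\Phi)$, i.e. $\sigma(\Phi)_i=\sharp\{j:\alpha_{i,l+1-j}\in\Phi\}$.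 Dyck paths. A Dyck path of length $2n$ is a word with $n$ letters $u$ and $n$ letters $d$ in which every prefix has at least as many $u$'s as $d$'s. A peak is an occurrence of two consecutive letters $ud$; its height is the number of $u$'s minus the number of $d$'s in the prefix ending with the $u$ of the peak; the highest peaks of a path are those of maximal height. Inserting $p\geqslant 0$ peaks on a peak means replacing the factor $ud$ by $u(ud)^pd$. The bijection $P$ from $l$-partitions to Dyck paths of length $2l+2$: $P(\lambda)$ is the word obtained by reading the boundary of the Ferrers diagram of $\lambda$, placed in the triangle with side $l+1$, from bottom left to top right, with up steps read as $u$ and right steps as $d$; explicitly $$P(\lambda)=u\,d^{\lambda_l-\lambda_{l+1}}\,u\,d^{\lambda_{l-1}-\lambda_l}\cdots u\,d^{\lambda_1-\lambda_2}\,u\,d^{\,l+1-\lambda_1}.$$ The bijection $D:\lambda\mapsto D_\lambda$ from $l$-partitions to Dyck paths of length $2l+2$ (Andrews–Krattenthaler–Orsina–Papi): let $k$ and $i_k>\cdots>i_1>0$ be defined by $i_k=\lambda_1$, $i_{j-1}=\lambda_{l-i_j+2}$, continuing as long as the values are positive (so $\lambda_{l-i_1+2}=0$; $k=0$ if $\lambda_1=0$); put $i_j=0$ for $j\leqslant 0$ and $i_j=l+1$ for $j>k$. For $1\leqslant j\leqslant k$ and $0\leqslant q\leqslant i_{j+1}-i_j-1$ put $a_{j,q}=\lambda_{l-i_{j+1}+2+q}-\lambda_{l-i_{j+1}+3+q}$. Start with $D_{k+1}=(ud)^{l+1-i_k}$. For $j=k,k-1,\dots,1$, the path $D_{j+1}$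 has exactly $i_{j+1}-i_j$ highest peaks, and $D_j$ is obtained from $D_{j+1}$ by inserting, for each $0\leqslant q\leqslant i_{j+1}-i_j-1$, $a_{j,q}$ peaks on the $(q+1)$-th highest peak (counted from the left) of $D_{j+1}$. Finally $D_\lambda=D_1$. *)

theory Defs
  imports Main "HOL-Library.Function_Algebras"
begin

text \<open>
  The simple root \<open>\<alpha>\<^sub>i\<close> of \<open>sl\<^sub>l\<^sub>+\<^sub>1\<close> is realised as
  \<open>\<epsilon>\<^sub>i - \<epsilon>\<^sub>i\<^sub>+\<^sub>1\<close>, where \<open>\<epsilon>\<^sub>k\<close> is the indicator of \<open>k\<close>. Sums and differences
  of roots are the pointwise ones on \<^typ>\<open>nat \<Rightarrow> int\<close>.
\<close>

definition simple_root :: "nat \<Rightarrow> nat \<Rightarrow> int" where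
  "simple_root i = (\<lambda>k. (if k = i then 1 else 0) - (if k = i + 1 then 1 else 0))"

definition root :: "nat \<Rightarrow> nat \<Rightarrow> nat \<Rightarrow> int" where
  "root i j = (\<Sum>k=i..j. simple_root k)"

definition pos_roots :: "nat \<Rightarrow> (nat \<Rightarrow> int) set" where
  "pos_roots l = {root i j | i j. 1 \<le> i \<and> i \<le> j \<and> j \<le> l}"

definition root_ideals :: "nat \<Rightarrow> (nat \<Rightarrow> int) set set" where
  "root_ideals l = {\<Phi>. \<Phi> \<subseteq> pos_roots l \<and>
     (\<forall>\<alpha>\<in>\<Phi>. \<forall>\<beta>\<in>pos_roots l. \<alpha> + \<beta> \<in> pos_roots l \<longrightarrow> \<alpha> + \<beta> \<in> \<Phi>)}"

definition min_roots :: "nat \<Rightarrow> (nat \<Rightarrow> int) set \<Rightarrow> (nat \<Rightarrow> int) set" where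
  "min_roots l \<Phi> = {\<beta> \<in> \<Phi>. \<forall>\<alpha>\<in>pos_roots l. \<beta> - \<alpha> \<notin> \<Phi>}"

text \<open>
  The parts of an \<open>l\<close>-partition are indexed by \<open>1, \<dots>, l\<close>; all other values are fixed to \<open>0\<close>,
  which includes the convention \<open>\<lambda>\<^sub>l\<^sub>+\<^sub>1 = 0\<close> and makes the representation unique.
\<close>

definition partitions :: "nat \<Rightarrow> (nat \<Rightarrow> nat) set" where
  "partitions l = {lam.
     (\<forall>i. 1 \<le> i \<and> i < l \<longrightarrow> lam (i + 1) \<le> lam i) \<and>
     (\<forall>i\<in>{1..l}. lam i \<le> l + 1 - i) \<and>
     (\<forall>i. i \<notin> {1..l} \<longrightarrow> lam i = 0)}"

text \<open>Row \<open>i\<close> of the Ferrers diagram of \<open>(l, l - 1, \<dots>, 1)\<close> has the columns \<open>1, \<dots>, l + 1 - i\<close>.\<close>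

definition sigma :: "nat \<Rightarrow> (nat \<Rightarrow> int) set \<Rightarrow> nat \<Rightarrow> nat" where
  "sigma l \<Phi> = (\<lambda>i. if i \<in> {1..l}
     then card {j \<in> {1..l + 1 - i}. root i (l + 1 - j) \<in> \<Phi>} else 0)"

datatype step = Up | Down

definition zigzag :: "nat \<Rightarrow> step list" where
  "zigzag p = concat (replicate p [Up, Down])"

definition peaks :: "step list \<Rightarrow> nat set" where
  "peaks w = {n. n + 1 < length w \<and> w ! n = Up \<and> w ! (n + 1) = Down}"

definition height :: "step list \<Rightarrow> nat \<Rightarrow> int" where
  "height w n = int (count_list (take (n + 1) w) Up) - int (count_list (take (n + 1) w) Down)"

definition highest_peaks :: "step list \<Rightarrow> nat set" where
  "highest_peaks w = {n \<in> peaks w. \<forall>m\<in>peaks w. height w m \<le> height w n}"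

text \<open>
  \<open>insert_peaks a w\<close> inserts, simultaneously for all \<open>q\<close>, \<open>a q\<close> peaks on the \<open>(q + 1)\<close>-th highest
  peak of \<open>w\<close> from the left. Replacing the factor \<open>ud\<close> by \<open>u(ud)\<^sup>pd\<close> amounts to writing \<open>(ud)\<^sup>p\<close>
  directly after the \<open>u\<close> of the peak; the highest peak at position \<open>n\<close> has index \<open>q\<close> if exactly
  \<open>q\<close> highest peaks lie to its left.
\<close>

definition insert_peaks :: "(nat \<Rightarrow> nat) \<Rightarrow> step list \<Rightarrow> step list" where
  "insert_peaks a w = concat (map (\<lambda>n. w ! n #
     (if n \<in> highest_peaks w then zigzag (a (card {m \<in> highest_peaks w. m < n})) else []))
     [0..<length w])"

definition P_path :: "nat \<Rightarrow> (nat \<Rightarrow> nat) \<Rightarrow> step list" where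
  "P_path l lam =
     concat (map (\<lambda>i. Up # replicate (lam i - lam (i + 1)) Down) (rev [1..<l + 1]))
     @ Up # replicate (l + 1 - lam 1) Down"

text \<open>
  \<open>descent l \<lambda> r\<close> is \<open>i\<^sub>k\<^sub>-\<^sub>r\<close> as long as it is positive: \<open>i\<^sub>k = \<lambda>\<^sub>1\<close> and \<open>i\<^sub>j\<^sub>-\<^sub>1\<close> is the part
  with index \<open>l - i\<^sub>j + 2\<close>.
\<close>

primrec descent :: "nat \<Rightarrow> (nat \<Rightarrow> nat) \<Rightarrow> nat \<Rightarrow> nat" where
  "descent l lam 0 = lam 1"
| "descent l lam (Suc r) = lam (l + 2 - descent l lam r)"

definition num_desc :: "nat \<Rightarrow> (nat \<Rightarrow> nat) \<Rightarrow> nat" where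
  "num_desc l lam = (LEAST r. descent l lam r = 0)"

definition idx :: "nat \<Rightarrow> (nat \<Rightarrow> nat) \<Rightarrow> nat \<Rightarrow> nat" where
  "idx l lam j = (if j = 0 then 0
     else if j > num_desc l lam then l + 1
     else descent l lam (num_desc l lam - j))"

text \<open>
  The number \<open>a\<^sub>j\<^sub>,\<^sub>q\<close>. The index \<open>l - i\<^sub>j\<^sub>+\<^sub>1 + 2 + q\<close> is written \<open>l + 2 - i\<^sub>j\<^sub>+\<^sub>1 + q\<close>, since
  \<open>l - i\<^sub>j\<^sub>+\<^sub>1\<close> would be truncated for \<open>i\<^sub>j\<^sub>+\<^sub>1 = l + 1\<close>.
\<close>

definition ins_num :: "nat \<Rightarrow> (nat \<Rightarrow> nat) \<Rightarrow> nat \<Rightarrow> nat \<Rightarrow> nat" where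
  "ins_num l lam j q = (if q < idx l lam (j + 1) - idx l lam j
     then lam (l + 2 - idx l lam (j + 1) + q) - lam (l + 3 - idx l lam (j + 1) + q)
     else 0)"

text \<open>\<open>D_stage l \<lambda> r\<close> is \<open>D\<^sub>k\<^sub>+\<^sub>1\<^sub>-\<^sub>r\<close> for \<open>0 \<le> r \<le> k\<close>.\<close>

primrec D_stage :: "nat \<Rightarrow> (nat \<Rightarrow> nat) \<Rightarrow> nat \<Rightarrow> step list" where
  "D_stage l lam 0 = zigzag (l + 1 - idx l lam (num_desc l lam))"
| "D_stage l lam (Suc r) =
     insert_peaks (ins_num l lam (num_desc l lam - r)) (D_stage l lam r)"

definition D_path :: "nat \<Rightarrow> (nat \<Rightarrow> nat) \<Rightarrow> step list" where
  "D_path l lam = D_stage l lam (num_desc l lam)"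

end

theory Submission
  imports Defs
begin

text \<open>
  Why the map complements the number of minimal roots becomes visible when a Dyck path is read as
  a plane forest, a matching pair of an up and a down step being a node and a peak being a leaf.
  Inserting \<open>a\<close> peaks on a highest peak gives a node of the deepest level \<open>a\<close> children. Hence
  \<open>D\<^sub>\<lambda>\<close> is the forest with \<open>l + 1 - \<lambda>\<^sub>1\<close> roots whose nodes, listed level by level from left to
  right, have \<open>\<lambda>\<^sub>1 - \<lambda>\<^sub>2, \<lambda>\<^sub>2 - \<lambda>\<^sub>3, \<dots>\<close> children: the numbers \<open>i\<^sub>j\<close> are defined just so that the
  level sizes fit. Such a sequence determines the forest and is determined by it, so \<open>D\<close> is
  injective (\<open>inj_on_D_path\<close>).

  The forest has \<open>l + 1\<close> nodes, and a node is a leaf iff its difference vanishes (the last one,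
  with the difference \<open>\<lambda>\<^sub>l\<^sub>+\<^sub>1 = 0\<close>, always is). So the number of peaks of \<open>D\<^sub>\<lambda>\<close>
  is \<open>l + 1\<close> minus the number of corners of \<open>\<lambda>\<close>, that is, of rows \<open>i\<close> with \<open>\<lambda>\<^sub>i > \<lambda>\<^sub>i\<^sub>+\<^sub>1\<close>
  (\<open>D_path_facts\<close>). On the other side \<open>P(\<mu>)\<close> follows the boundary of the diagram of \<open>\<mu>\<close>, and its
  peaks are the corners of \<open>\<mu>\<close> and one further peak at the end (\<open>num_peaks_P_path\<close>). If
  \<open>P(\<mu>) = D\<^sub>\<lambda>\<close>, the corners of \<open>\<lambda>\<close> and \<open>\<mu>\<close> therefore add up to \<open>l\<close>. The corners of \<open>\<sigma>(\<Phi>)\<close> are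
  the cells of the minimal roots of \<open>\<Phi>\<close> (\<open>card_min_roots\<close>), which gives the statement on
  \<open>\<Phi>\<^sub>m\<^sub>i\<^sub>n\<close>.

  For bijectivity it is enough that the composite is an injective map of the finite set of root
  ideals into itself. This needs that \<open>\<sigma>\<close> is injective and onto, that \<open>D\<close> is injective, and that
  \<open>P\<close> reaches every Dyck path (\<open>P_path_surj\<close>), so that the inverse images chosen by \<open>inv_into\<close>
  exist; distinct paths then have distinct inverse images by themselves.
\<close>

section \<open>Root ideals and partitions\<close>

lemma root_eq:
  assumes "i \<le> j"
  shows "root i j = (\<lambda>k. (if k = i then 1 else 0) - (if k = Suc j then 1 else 0))"
  using assms
proof (induction j rule: dec_induct)
  case base
  then show ?case by (simp add: root_def simple_root_def)
next
  case (step n)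
  have "root i (Suc n) = root i n + simple_root (Suc n)"
    using step by (simp add: root_def)
  then show ?case
    using step by (auto simp: simple_root_def fun_eq_iff)
qed

lemma root_inject:
  assumes "i \<le> j" "i' \<le> j'" "root i j = root i' j'"
  shows "i = i' \<and> j = j'"
proof -
  have "root i j i = root i' j' i" "root i j (Suc j) = root i' j' (Suc j)"
    using assms(3) by auto
  then show ?thesis
    using assms(1,2) by (auto simp: root_eq split: if_splits)
qed

lemma root_add: "i \<le> m \<Longrightarrow> m < j \<Longrightarrow> root i m + root (Suc m) j = root i j"
  by (auto simp: root_eq fun_eq_iff)

text \<open>
  A root \<open>root i j\<close> is \<open>\<epsilon>\<^sub>i - \<epsilon>\<^sub>j\<^sub>+\<^sub>1\<close>. In a sum of two of them that is again of this form one positive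
  and one negative entry must cancel, so the two index intervals are adjacent.
\<close>

lemma root_add_eq_rootD:
  assumes "i \<le> j" "i' \<le> j'" "p \<le> q" and eq: "root i j + root i' j' = root p q"
  shows "(i' = Suc j \<and> p = i \<and> q = j') \<or> (i = Suc j' \<and> p = i' \<and> q = j)"
proof -
  have *: "root i j x + root i' j' x = root p q x" for x
    using eq by (metis plus_fun_apply)
  show ?thesis
    using assms(1-3) *[of i] *[of i'] *[of p] *[of "Suc j"] *[of "Suc j'"] *[of "Suc q"]
    by (simp add: root_eq split: if_splits)
qed

lemma pos_rootsI: "1 \<le> i \<Longrightarrow> i \<le> j \<Longrightarrow> j \<le> l \<Longrightarrow> root i j \<in> pos_roots l"
  by (auto simp: pos_roots_def)

lemma finite_root_ideals: "finite (root_ideals l)"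
proof -
  have "pos_roots l \<subseteq> (\<lambda>(i, j). root i j) ` ({1..l} \<times> {1..l})"
    by (force simp: pos_roots_def)
  then have "finite (pos_roots l)"
    by (rule finite_subset) auto
  moreover have "root_ideals l \<subseteq> Pow (pos_roots l)"
    by (auto simp: root_ideals_def)
  ultimately show ?thesis
    by (meson finite_Pow_iff finite_subset)
qed

text \<open>
  The cell of a root in an ideal brings along all cells above it and to its left in the staircase:
  \<open>root i j\<close> is enlarged first by \<open>root (j + 1) j'\<close>, then by \<open>root i' (i - 1)\<close>.
\<close>

lemma root_ideal_mono:
  assumes "\<Phi> \<in> root_ideals l" "root i j \<in> \<Phi>" "1 \<le> i'" "i' \<le> i" "i \<le> j" "j \<le> j'" "j' \<le> l"
  shows "root i' j' \<in> \<Phi>"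
proof -
  have up: "\<alpha> + \<beta> \<in> \<Phi>" if "\<alpha> \<in> \<Phi>" "\<beta> \<in> pos_roots l" "\<alpha> + \<beta> \<in> pos_roots l" for \<alpha> \<beta>
    using assms(1) that by (auto simp: root_ideals_def)
  have right: "root i j' \<in> \<Phi>"
  proof (cases "j = j'")
    case False
    then have "root i j + root (Suc j) j' = root i j'"
      using assms by (intro root_add) auto
    then show ?thesis
      using up[OF assms(2), of "root (Suc j) j'"] False assms
        pos_rootsI[of "Suc j" j' l] pos_rootsI[of i j' l] by auto
  qed (use assms in auto)
  show ?thesis
  proof (cases "i' = i")
    case False
    then have "root i' (i - 1) + root i j' = root i' j'"
      using root_add[of i' "i - 1" j'] assms by auto
    then have "root i j' + root i' (i - 1) = root i' j'"
      by (simp add: add.commute)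
    then show ?thesis
      using up[OF right, of "root i' (i - 1)"] False assms
        pos_rootsI[of i' "i - 1" l] pos_rootsI[of i' j' l] by auto
  qed (use right in auto)
qed

lemma partition_antimono:
  assumes "lam \<in> partitions l" "1 \<le> i" "i \<le> j"
  shows "lam j \<le> lam i"
  using assms(3)
proof (induction j rule: dec_induct)
  case (step n)
  have "lam (Suc n) \<le> lam n"
  proof (cases "n < l")
    case True
    then show ?thesis using assms step by (auto simp: partitions_def)
  next
    case False
    then show ?thesis using assms by (auto simp: partitions_def)
  qed
  then show ?case using step by simp
qed simp

lemma partition_le: "lam \<in> partitions l \<Longrightarrow> 1 \<le> i \<Longrightarrow> lam i \<le> l + 1 - i"
  by (cases "i \<le> l") (auto simp: partitions_def)

lemma partition_outside: "lam \<in> partitions l \<Longrightarrow> i = 0 \<or> l < i \<Longrightarrow> lam i = 0"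
  by (auto simp: partitions_def)

lemma card_initial_segment:
  fixes A :: "nat set"
  assumes "A \<subseteq> {1..n}" "\<And>j k. k \<in> A \<Longrightarrow> 1 \<le> j \<Longrightarrow> j \<le> k \<Longrightarrow> j \<in> A"
  shows "A = {1..card A}"
proof (cases "A = {}")
  case False
  have fin: "finite A" using assms(1) finite_subset by blast
  have "A = {1..Max A}"
    using assms Max_in[OF fin False] Max_ge[OF fin] by fastforce
  then show ?thesis by (metis card_atLeastAtMost diff_Suc_1)
qed auto

text \<open>
  The cells of an ideal are left-justified in each row, hence counting them is the same as
  recording them. This makes \<open>\<sigma>\<close> injective.
\<close>

lemma root_in_ideal_iff:
  assumes "\<Phi> \<in> root_ideals l" "1 \<le> i" "i \<le> j" "j \<le> l"
  shows "root i j \<in> \<Phi> \<longleftrightarrow> l + 1 - j \<le> sigma l \<Phi> i"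
proof -
  let ?A = "{j \<in> {1..l + 1 - i}. root i (l + 1 - j) \<in> \<Phi>}"
  have "?A = {1..card ?A}"
  proof (rule card_initial_segment)
    fix j k assume "k \<in> ?A" "1 \<le> j" "j \<le> k"
    then show "j \<in> ?A"
      using root_ideal_mono[OF assms(1), of i "l + 1 - k" i "l + 1 - j"] assms by auto
  qed auto
  moreover have "sigma l \<Phi> i = card ?A"
    using assms by (simp add: sigma_def)
  ultimately have A: "?A = {1..sigma l \<Phi> i}" by simp
  have "root i j \<in> \<Phi> \<longleftrightarrow> l + 1 - j \<in> ?A"
    using assms by auto
  also have "\<dots> \<longleftrightarrow> l + 1 - j \<le> sigma l \<Phi> i"
    unfolding A using assms by auto
  finally show ?thesis .
qed

lemma sigma_in_partitions:
  assumes "\<Phi> \<in> root_ideals l"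
  shows "sigma l \<Phi> \<in> partitions l"
proof -
  have "sigma l \<Phi> (i + 1) \<le> sigma l \<Phi> i" if "1 \<le> i" "i < l" for i
  proof -
    have "{j \<in> {1..l + 1 - (i + 1)}. root (i + 1) (l + 1 - j) \<in> \<Phi>}
        \<subseteq> {j \<in> {1..l + 1 - i}. root i (l + 1 - j) \<in> \<Phi>}"
      using that root_ideal_mono[OF assms, of "i + 1" _ i] by auto
    then show ?thesis
      using that by (simp add: sigma_def card_mono)
  qed
  moreover have "sigma l \<Phi> i \<le> l + 1 - i" if "i \<in> {1..l}" for i
  proof -
    have "card {j \<in> {1..l + 1 - i}. root i (l + 1 - j) \<in> \<Phi>} \<le> card {1..l + 1 - i}"
      by (intro card_mono) auto
    then show ?thesis using that by (simp add: sigma_def)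
  qed
  ultimately show ?thesis
    by (auto simp: partitions_def sigma_def)
qed

lemma inj_on_sigma: "inj_on (sigma l) (root_ideals l)"
proof (rule inj_onI)
  have sub: "\<Phi> \<subseteq> \<Psi>"
    if ideals: "\<Phi> \<in> root_ideals l" "\<Psi> \<in> root_ideals l"
      and eq: "sigma l \<Phi> = sigma l \<Psi>" for \<Phi> \<Psi>
  proof
    fix \<alpha> assume \<alpha>: "\<alpha> \<in> \<Phi>"
    then obtain i j where "\<alpha> = root i j" "1 \<le> i" "i \<le> j" "j \<le> l"
      using ideals(1) unfolding root_ideals_def pos_roots_def by blast
    then show "\<alpha> \<in> \<Psi>"
      using \<alpha> ideals eq by (simp add: root_in_ideal_iff)
  qed
  fix \<Phi> \<Psi> assume "\<Phi> \<in> root_ideals l" "\<Psi> \<in> root_ideals l" "sigma l \<Phi> = sigma l \<Psi>"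
  then show "\<Phi> = \<Psi>" using sub by (metis subset_antisym)
qed

lemma partitions_subset_sigma_image: "partitions l \<subseteq> sigma l ` root_ideals l"
proof
  fix lam assume lam: "lam \<in> partitions l"
  define \<Phi> where "\<Phi> = {root i j | i j. 1 \<le> i \<and> i \<le> j \<and> j \<le> l \<and> l + 1 - j \<le> lam i}"
  have mem: "root i j \<in> \<Phi> \<longleftrightarrow> l + 1 - j \<le> lam i" if "1 \<le> i" "i \<le> j" "j \<le> l" for i j
    using that root_inject unfolding \<Phi>_def by blast
  have ideal: "\<Phi> \<in> root_ideals l"
    unfolding root_ideals_def
  proof (intro CollectI conjI ballI impI)
    show "\<Phi> \<subseteq> pos_roots l" by (auto simp: \<Phi>_def pos_roots_def)
    fix \<alpha> \<beta> assume "\<alpha> \<in> \<Phi>" "\<beta> \<in> pos_roots l" "\<alpha> + \<beta> \<in> pos_roots l"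
    then obtain i j i' j' p q where
      ij: "\<alpha> = root i j" "1 \<le> i" "i \<le> j" "j \<le> l" "l + 1 - j \<le> lam i"
      and ij': "\<beta> = root i' j'" "1 \<le> i'" "i' \<le> j'" "j' \<le> l"
      and pq: "\<alpha> + \<beta> = root p q" "1 \<le> p" "p \<le> q" "q \<le> l"
      unfolding \<Phi>_def pos_roots_def by blast
    have "p \<le> i \<and> j \<le> q"
      using root_add_eq_rootD[of i j i' j' p q] ij ij' pq by auto
    then have "l + 1 - q \<le> lam p"
      using partition_antimono[OF lam, of p i] pq ij by linarith
    then show "\<alpha> + \<beta> \<in> \<Phi>"
      using mem pq by simp
  qed
  have "sigma l \<Phi> i = lam i" for i
  proof (cases "i \<in> {1..l}")
    case True
    have "{j \<in> {1..l + 1 - i}. root i (l + 1 - j) \<in> \<Phi>} = {1..lam i}"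
      using True partition_le[OF lam, of i] mem by auto
    then show ?thesis using True by (simp add: sigma_def)
  next
    case False
    then show ?thesis using lam by (auto simp: sigma_def partitions_def)
  qed
  then have "sigma l \<Phi> = lam" by auto
  then show "lam \<in> sigma l ` root_ideals l" using ideal by blast
qed

definition corners :: "nat \<Rightarrow> (nat \<Rightarrow> nat) \<Rightarrow> nat set" where
  "corners l lam = {i \<in> {1..l}. lam (i + 1) < lam i}"

text \<open>
  By the adjacency of summands, \<open>root i j - \<alpha>\<close> is a root only if \<open>\<alpha>\<close> cuts off an end of the
  interval from \<open>i\<close> to \<open>j\<close>; since ideals are closed upwards, cutting off a single simple root at
  either end is the decisive case.
\<close>

lemma min_root_iff:
  assumes \<Phi>: "\<Phi> \<in> root_ideals l" and ij: "1 \<le> i" "i \<le> j" "j \<le> l"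
  shows "root i j \<in> min_roots l \<Phi> \<longleftrightarrow>
    root i j \<in> \<Phi> \<and> (i < j \<longrightarrow> root i (j - 1) \<notin> \<Phi>) \<and> (i < j \<longrightarrow> root (Suc i) j \<notin> \<Phi>)"
    (is "?L \<longleftrightarrow> ?R")
proof
  assume L: ?L
  have "root i (j - 1) \<notin> \<Phi>" "root (Suc i) j \<notin> \<Phi>" if "i < j"
  proof -
    have "root i j - root j j = root i (j - 1)"
      using root_add[of i "j - 1" j] that by (auto simp: algebra_simps)
    moreover have "root i j - root i i = root (Suc i) j"
      using root_add[of i i j] that by (auto simp: algebra_simps)
    moreover have "root j j \<in> pos_roots l" "root i i \<in> pos_roots l"
      using ij by (auto intro!: pos_rootsI)
    ultimately show "root i (j - 1) \<notin> \<Phi>" "root (Suc i) j \<notin> \<Phi>"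
      using L by (auto simp: min_roots_def)
  qed
  then show ?R using L by (auto simp: min_roots_def)
next
  assume R: ?R
  have "root i j - \<alpha> \<notin> \<Phi>" if "\<alpha> \<in> pos_roots l" for \<alpha>
  proof
    assume in\<Phi>: "root i j - \<alpha> \<in> \<Phi>"
    then obtain p q where pq: "root i j - \<alpha> = root p q" "1 \<le> p" "p \<le> q" "q \<le> l"
      using \<Phi> by (auto simp: root_ideals_def pos_roots_def)
    obtain r s where rs: "\<alpha> = root r s" "1 \<le> r" "r \<le> s" "s \<le> l"
      using \<open>\<alpha> \<in> pos_roots l\<close> by (auto simp: pos_roots_def)
    have "root p q + root r s = root i j"
      using pq(1) rs(1) by (simp add: algebra_simps)
    then have "(r = Suc q \<and> i = p \<and> j = s) \<or> (p = Suc s \<and> i = r \<and> j = q)"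
      using root_add_eq_rootD[of p q r s i j] pq rs ij by auto
    then show False
    proof
      assume *: "r = Suc q \<and> i = p \<and> j = s"
      then have "q \<le> j - 1" "j - 1 \<le> l" "i < j" using pq rs ij by linarith+
      then show False
        using root_ideal_mono[OF \<Phi>, of p q i "j - 1"] * in\<Phi> pq R ij by simp
    next
      assume "p = Suc s \<and> i = r \<and> j = q"
      then show False
        using root_ideal_mono[OF \<Phi>, of p q "Suc i" j] in\<Phi> pq rs R ij by auto
    qed
  qed
  then show ?L using R by (simp add: min_roots_def)
qed

text \<open>
  In the diagram, the two conditions of the preceding lemma say that the cells to the right of and
  below the cell of the root are missing; so each corner row contributes its last cell.
\<close>

lemma card_min_roots:
  assumes \<Phi>: "\<Phi> \<in> root_ideals l"
  shows "card (min_roots l \<Phi>) = card (corners l (sigma l \<Phi>))"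
proof -
  let ?s = "sigma l \<Phi>"
  have s: "?s \<in> partitions l" by (rule sigma_in_partitions[OF \<Phi>])
  have iff: "root i j \<in> min_roots l \<Phi> \<longleftrightarrow> i \<in> corners l ?s \<and> j = l + 1 - ?s i"
    if ij: "1 \<le> i" "i \<le> j" "j \<le> l" for i j
  proof -
    have eq: "root i j \<in> \<Phi> \<longleftrightarrow> l + 1 - j \<le> ?s i"
      using \<Phi> ij by (rule root_in_ideal_iff)
    have "i < j \<Longrightarrow> root i (j - 1) \<in> \<Phi> \<longleftrightarrow> l + 2 - j \<le> ?s i"
      using root_in_ideal_iff[OF \<Phi>, of i "j - 1"] ij by auto
    moreover have "i < j \<Longrightarrow> root (Suc i) j \<in> \<Phi> \<longleftrightarrow> l + 1 - j \<le> ?s (Suc i)"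
      using root_in_ideal_iff[OF \<Phi>, of "Suc i" j] ij by auto
    ultimately show ?thesis
      unfolding min_root_iff[OF \<Phi> ij] eq corners_def
      using ij partition_le[OF s, of i] partition_le[OF s, of "Suc i"]
      by (cases "i < j") auto
  qed
  have "min_roots l \<Phi> = (\<lambda>i. root i (l + 1 - ?s i)) ` corners l ?s"
  proof (intro equalityI subsetI)
    fix \<beta> assume \<beta>: "\<beta> \<in> min_roots l \<Phi>"
    then have "\<beta> \<in> pos_roots l" using \<Phi> by (auto simp: min_roots_def root_ideals_def)
    then obtain i j where "\<beta> = root i j" "1 \<le> i" "i \<le> j" "j \<le> l"
      by (auto simp: pos_roots_def)
    then show "\<beta> \<in> (\<lambda>i. root i (l + 1 - ?s i)) ` corners l ?s"
      using iff \<beta> by auto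
  next
    fix \<beta> assume "\<beta> \<in> (\<lambda>i. root i (l + 1 - ?s i)) ` corners l ?s"
    then obtain i where i: "\<beta> = root i (l + 1 - ?s i)" "i \<in> corners l ?s" by auto
    then show "\<beta> \<in> min_roots l \<Phi>"
      using iff[of i "l + 1 - ?s i"] partition_le[OF s, of i] by (auto simp: corners_def)
  qed
  moreover have "inj_on (\<lambda>i. root i (l + 1 - ?s i)) (corners l ?s)"
  proof (rule inj_onI)
    fix x y assume "x \<in> corners l ?s" "y \<in> corners l ?s"
      and "root x (l + 1 - ?s x) = root y (l + 1 - ?s y)"
    then show "x = y"
      using root_inject[of x "l + 1 - ?s x" y "l + 1 - ?s y"]
        partition_le[OF s, of x] partition_le[OF s, of y] by (auto simp: corners_def)
  qed
  ultimately show ?thesis by (simp add: card_image)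
qed

section \<open>Growing a Dyck path at its top level\<close>

text \<open>
  All properties of paths below are proved along the word, so they are stated for a path that
  starts at height \<open>c\<close>. \<open>fits h c w\<close> means that \<open>w\<close> stays between the levels \<open>0\<close> and \<open>h\<close> and ends
  at \<open>0\<close>; for \<open>c = 0\<close> and some \<open>h\<close> these are the Dyck paths.
\<close>

fun fits :: "nat \<Rightarrow> nat \<Rightarrow> step list \<Rightarrow> bool" where
  "fits h c [] \<longleftrightarrow> c = 0"
| "fits h c (Up # w) \<longleftrightarrow> c < h \<and> fits h (Suc c) w"
| "fits h c (Down # w) \<longleftrightarrow> 0 < c \<and> fits h (c - 1) w"

fun rises :: "nat \<Rightarrow> nat \<Rightarrow> step list \<Rightarrow> nat" where
  "rises h c [] = 0"
| "rises h c (Up # w) = (if Suc c = h then Suc (rises h (Suc c) w) else rises h (Suc c) w)"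
| "rises h c (Down # w) = rises h (c - 1) w"

text \<open>
  \<open>rises\<close> counts the up steps that reach the level \<open>h\<close>, and \<open>grow\<close> inserts peaks directly after
  them. On a path that fits below \<open>h\<close> and reaches \<open>h\<close>, these steps are the highest peaks, so
  \<open>grow\<close> is a version of \<open>insert_peaks\<close> that consumes the word and the numbers in parallel.
\<close>

fun grow :: "nat \<Rightarrow> nat \<Rightarrow> (nat \<Rightarrow> nat) \<Rightarrow> step list \<Rightarrow> step list" where
  "grow h c a [] = []"
| "grow h c a (Up # w) =
    (if Suc c = h then Up # zigzag (a 0) @ grow h (Suc c) (a \<circ> Suc) w
     else Up # grow h (Suc c) a w)"
| "grow h c a (Down # w) = Down # grow h (c - 1) a w"

primrec num_peaks :: "step list \<Rightarrow> nat" where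
  "num_peaks [] = 0"
| "num_peaks (x # w) = (if x = Up \<and> w \<noteq> [] \<and> hd w = Down then 1 else 0) + num_peaks w"

lemma zigzag_simps [simp]:
  "zigzag 0 = []" "zigzag (Suc p) = Up # Down # zigzag p"
  by (simp_all add: zigzag_def)

text \<open>
  At the top level the path can only go down: this is why every up step that reaches it is a peak.
\<close>

lemma fits_top:
  assumes "fits h h w" "0 < h"
  shows "\<exists>v. w = Down # v"
  using assms by (cases "(h, h, w)" rule: fits.cases) auto

lemma height_Cons_0: "height (x # w) 0 = (if x = Up then 1 else - 1)"
  by (cases x) (auto simp: height_def)

lemma height_Cons_Suc: "height (x # w) (Suc n) = (if x = Up then 1 else - 1) + height w n"
  by (cases x) (auto simp: height_def)

lemma fits_height_le:
  "fits h c w \<Longrightarrow> c \<le> h \<Longrightarrow> n < length w \<Longrightarrow> int c + height w n \<le> int h"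
proof (induction h c w arbitrary: n rule: fits.induct)
  case (2 h c w)
  then show ?case
    by (cases n) (force simp: height_Cons_0 height_Cons_Suc)+
next
  case (3 h c w)
  then show ?case
    by (cases n) (force simp: height_Cons_0 height_Cons_Suc of_nat_diff)+
qed simp

lemma fits_Up_at_top_is_peak:
  "fits h c w \<Longrightarrow> c \<le> h \<Longrightarrow> n < length w \<Longrightarrow> w ! n = Up \<Longrightarrow> int c + height w n = int h \<Longrightarrow>
   Suc n < length w \<and> w ! Suc n = Down"
proof (induction h c w arbitrary: n rule: fits.induct)
  case (2 h c w)
  show ?case
  proof (cases n)
    case 0
    then have "Suc c = h" using 2 by (simp add: height_Cons_0)
    then obtain v where "w = Down # v" using fits_top[of h w] 2 by auto
    then show ?thesis using 0 by simp
  next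
    case (Suc m)
    then show ?thesis using 2 by (auto simp: height_Cons_Suc)
  qed
next
  case (3 h c w)
  then obtain m where "n = Suc m" by (cases n) auto
  then show ?case using 3 by (auto simp: height_Cons_Suc of_nat_diff)
qed simp

definition top_ups :: "int \<Rightarrow> step list \<Rightarrow> nat set" where
  "top_ups d w = {n. n < length w \<and> w ! n = Up \<and> height w n = d}"

lemma top_ups_Cons:
  "top_ups d (x # w) =
    (if x = Up \<and> d = 1 then {0} else {}) \<union> Suc ` top_ups (d - (if x = Up then 1 else - 1)) w"
proof (rule set_eqI)
  fix n
  show "n \<in> top_ups d (x # w) \<longleftrightarrow>
    n \<in> (if x = Up \<and> d = 1 then {0} else {}) \<union> Suc ` top_ups (d - (if x = Up then 1 else - 1)) w"
    by (cases n; cases x) (auto simp: top_ups_def height_Cons_0 height_Cons_Suc)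
qed

lemma finite_top_ups: "finite (top_ups d w)"
  by (simp add: top_ups_def)

lemma rises_eq_card:
  "fits h c w \<Longrightarrow> c \<le> h \<Longrightarrow> rises h c w = card (top_ups (int h - int c) w)"
proof (induction h c w rule: fits.induct)
  case (1 h c)
  then show ?case by (simp add: top_ups_def)
next
  case (2 h c w)
  define d where "d = int h - int (Suc c)"
  have "int h - int c = 1 \<longleftrightarrow> Suc c = h" "int h - int c - 1 = d" by (auto simp: d_def)
  moreover have "rises h (Suc c) w = card (top_ups d w)" using 2 by (simp add: d_def)
  ultimately show ?case
    by (auto simp: top_ups_Cons card_image finite_top_ups)
next
  case (3 h c w)
  then show ?case by (simp add: top_ups_Cons card_image of_nat_diff algebra_simps)
qed

text \<open>
  The path attains its upper bound \<open>h\<close>, and by \<open>fits_top\<close> every up step that gets there is a peak,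
  hence a highest one. Without a step that reaches \<open>h\<close>, the highest peaks would lie lower.
\<close>

lemma highest_peaks_eq_top_ups:
  assumes "fits h 0 w" "0 < rises h 0 w"
  shows "highest_peaks w = top_ups (int h) w"
proof -
  have le: "height w n \<le> int h" if "n < length w" for n
    using fits_height_le[OF assms(1) _ that] by simp
  have peak: "n \<in> peaks w" if "n \<in> top_ups (int h) w" for n
    using that fits_Up_at_top_is_peak[OF assms(1), of n] by (auto simp: top_ups_def peaks_def)
  obtain m where m: "m \<in> top_ups (int h) w"
    using rises_eq_card[OF assms(1)] assms(2) by (fastforce simp: card_gt_0_iff)
  have "height w n = int h" if "n \<in> highest_peaks w" for n
    using that peak[OF m] m le[of n] by (force simp: highest_peaks_def peaks_def top_ups_def)
  then have "highest_peaks w \<subseteq> top_ups (int h) w"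
    by (auto simp: highest_peaks_def peaks_def top_ups_def)
  moreover have "n \<in> highest_peaks w" if "n \<in> top_ups (int h) w" for n
  proof -
    have "height w m \<le> height w n" if "m \<in> peaks w" for m
      using le[of m] that \<open>n \<in> top_ups (int h) w\<close> by (simp add: peaks_def top_ups_def)
    then show ?thesis using peak[OF that] by (simp add: highest_peaks_def)
  qed
  ultimately show ?thesis by blast
qed

text \<open>
  Prepending a step to a path shifts all positions by one; the index of a highest peak changes
  exactly if the new step is itself one of the marked positions.
\<close>

lemma card_shifted_below:
  fixes A :: "nat set"
  assumes "finite A"
  shows "card {m \<in> Suc ` A. m < Suc n} = card {m \<in> A. m < n}"
    "card {m \<in> insert 0 (Suc ` A). m < Suc n} = Suc (card {m \<in> A. m < n})"
proof -
  have *: "{m \<in> Suc ` A. m < Suc n} = Suc ` {m \<in> A. m < n}" by auto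
  then show "card {m \<in> Suc ` A. m < Suc n} = card {m \<in> A. m < n}"
    by (simp add: card_image)
  have "{m \<in> insert 0 (Suc ` A). m < Suc n} = insert 0 (Suc ` {m \<in> A. m < n})" by auto
  then show "card {m \<in> insert 0 (Suc ` A). m < Suc n} = Suc (card {m \<in> A. m < n})"
    using assms by (simp add: card_image)
qed

text \<open>
  The set \<open>H\<close> of marked positions is a separate variable, equal to \<open>top_ups\<close>, so that the map in
  the statement can be compared step by step with the one for the rest of the word.
\<close>

lemma grow_eq_insertion:
  "fits h c w \<Longrightarrow> c \<le> h \<Longrightarrow> H = top_ups (int h - int c) w \<Longrightarrow>
   concat (map (\<lambda>n. w ! n # (if n \<in> H then zigzag (a (card {m \<in> H. m < n})) else []))
     [0..<length w]) = grow h c a w"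
proof (induction h c w arbitrary: a H rule: fits.induct)
  case (1 h c)
  then show ?case by simp
next
  case (2 h c w)
  define H' where "H' = top_ups (int h - int (Suc c)) w"
  have H: "H = (if Suc c = h then insert 0 (Suc ` H') else Suc ` H')"
    using 2 by (auto simp: H'_def top_ups_Cons algebra_simps)
  have IH: "concat (map (\<lambda>n. w ! n # (if n \<in> H' then zigzag (b (card {m \<in> H'. m < n})) else []))
     [0..<length w]) = grow h (Suc c) b w" for b
    using 2 unfolding H'_def by auto
  have fin: "finite H'" by (simp add: H'_def finite_top_ups)
  have upt: "[0..<length (Up # w)] = 0 # map Suc [0..<length w]"
    by (simp add: upt_conv_Cons map_Suc_upt del: upt_Suc)
  show ?case
  proof (cases "Suc c = h")
    case True
    then have "0 \<in> H" "\<And>n. Suc n \<in> H \<longleftrightarrow> n \<in> H'"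
      "\<And>n. card {m \<in> H. m < Suc n} = Suc (card {m \<in> H'. m < n})"
      using H card_shifted_below(2)[OF fin] by auto
    then show ?thesis
      using True IH[of "a \<circ> Suc"] unfolding upt by (simp add: comp_def cong: if_cong)
  next
    case False
    then have "0 \<notin> H" "\<And>n. Suc n \<in> H \<longleftrightarrow> n \<in> H'"
      "\<And>n. card {m \<in> H. m < Suc n} = card {m \<in> H'. m < n}"
      using H card_shifted_below(1)[OF fin] by auto
    then show ?thesis
      using False IH[of a] unfolding upt by (simp add: comp_def cong: if_cong)
  qed
next
  case (3 h c w)
  define H' where "H' = top_ups (int h - int (c - 1)) w"
  have H: "H = Suc ` H'"
  proof -
    obtain b where "c = Suc b" using 3(2) by (cases c) auto
    then show ?thesis unfolding H'_def 3(4) top_ups_Cons by simp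
  qed
  have IH: "concat (map (\<lambda>n. w ! n # (if n \<in> H' then zigzag (a (card {m \<in> H'. m < n})) else []))
     [0..<length w]) = grow h (c - 1) a w"
    using 3 unfolding H'_def by auto
  have fin: "finite H'" by (simp add: H'_def finite_top_ups)
  have upt: "[0..<length (Down # w)] = 0 # map Suc [0..<length w]"
    by (simp add: upt_conv_Cons map_Suc_upt del: upt_Suc)
  have "0 \<notin> H" "\<And>n. Suc n \<in> H \<longleftrightarrow> n \<in> H'"
    "\<And>n. card {m \<in> H. m < Suc n} = card {m \<in> H'. m < n}"
    using H card_shifted_below(1)[OF fin] by auto
  then show ?case
    using IH unfolding upt by (simp add: comp_def cong: if_cong)
qed

lemma insert_peaks_eq_grow:
  assumes "fits h 0 w" "0 < rises h 0 w"
  shows "insert_peaks a w = grow h 0 a w"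
  unfolding insert_peaks_def highest_peaks_eq_top_ups[OF assms]
  by (rule grow_eq_insertion) (use assms in auto)

lemma fits_zigzag: "c < h \<Longrightarrow> fits h c (zigzag p @ w) \<longleftrightarrow> fits h c w"
  by (induction p) auto

lemma rises_zigzag: "rises (Suc h) h (zigzag p @ w) = p + rises (Suc h) h w"
  by (induction p) auto

lemma length_zigzag: "length (zigzag p) = 2 * p"
  by (induction p) auto

lemma zigzag_append_eqD:
  "zigzag p @ Down # v = zigzag q @ Down # w \<Longrightarrow> p = q \<and> v = w"
proof (induction p arbitrary: q)
  case 0
  then show ?case by (cases q) auto
next
  case (Suc p)
  then show ?case by (cases q) auto
qed

lemma num_peaks_zigzag_append:
  "num_peaks (zigzag p @ Down # w) = p + num_peaks w"
  by (induction p) auto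

lemma num_peaks_Up_zigzag:
  "num_peaks (Up # zigzag p @ Down # w) = Suc (p - 1) + num_peaks w"
  by (cases p) (auto simp: num_peaks_zigzag_append)

lemma grow_eq_Nil_iff: "grow h c a w = [] \<longleftrightarrow> w = []"
  by (cases "(h, c, w)" rule: fits.cases) auto

lemma hd_grow: "w \<noteq> [] \<Longrightarrow> hd (grow h c a w) = hd w"
  by (cases "(h, c, w)" rule: fits.cases) auto

lemma fits_grow: "fits h c w \<Longrightarrow> fits (Suc h) c (grow h c a w)"
  by (induction h c w arbitrary: a rule: fits.induct) (auto simp: fits_zigzag)

text \<open>
  The new top level consists of the inserted peaks.
\<close>

lemma rises_grow:
  "fits h c w \<Longrightarrow> rises (Suc h) c (grow h c a w) = (\<Sum>q<rises h c w. a q)"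
  by (induction h c w arbitrary: a rule: fits.induct)
    (auto simp: rises_zigzag sum.lessThan_Suc_shift simp del: sum.lessThan_Suc)

lemma length_grow: "length (grow h c a w) = length w + 2 * (\<Sum>q<rises h c w. a q)"
  by (induction h c w arbitrary: a rule: fits.induct)
    (auto simp: length_zigzag sum.lessThan_Suc_shift simp del: sum.lessThan_Suc)

text \<open>
  Inserting \<open>a\<close> peaks on a peak turns one peak into \<open>a\<close> peaks if \<open>a > 0\<close> and changes nothing if
  \<open>a = 0\<close>. In both cases the gain is the truncated difference \<open>a - 1\<close>.
\<close>

lemma num_peaks_grow:
  "fits h c w \<Longrightarrow> num_peaks (grow h c a w) = num_peaks w + (\<Sum>q<rises h c w. a q - 1)"
proof (induction h c w arbitrary: a rule: fits.induct)
  case (2 h c w)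
  show ?case
  proof (cases "Suc c = h")
    case True
    then obtain v where v: "w = Down # v" using fits_top[of h w] 2 by auto
    then show ?thesis
      using 2 True num_peaks_Up_zigzag[of "a 0"]
      by (simp add: sum.lessThan_Suc_shift del: sum.lessThan_Suc)
  next
    case False
    then show ?thesis using 2 by (cases "w = []") (auto simp: grow_eq_Nil_iff hd_grow)
  qed
qed auto

text \<open>
  In the grown path, the peaks inserted at a top step of the old path are followed by a down step
  of the old path, so their number can be read off; the rest of the word is copied. Growing can
  therefore be undone, and both the old path and the inserted numbers are recovered.
\<close>

lemma grow_inject:
  "fits h c v \<Longrightarrow> fits h c w \<Longrightarrow> grow h c a v = grow h c b w \<Longrightarrow>
   v = w \<and> (\<forall>q<rises h c v. a q = b q)"
proof (induction h c v arbitrary: a b w rule: fits.induct)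
  case (1 h c)
  then show ?case by (metis grow_eq_Nil_iff grow.simps(1) rises.simps(1) less_nat_zero_code)
next
  case (2 h c v)
  have "grow h c b w \<noteq> [] \<and> hd (grow h c b w) = Up"
    unfolding 2(4)[symmetric] by simp
  then have "w \<noteq> []" "hd w = Up"
    using grow_eq_Nil_iff[of h c b w] hd_grow[of w h c b] by auto
  then obtain w' where w: "w = Up # w'" by (cases w) auto
  show ?case
  proof (cases "Suc c = h")
    case True
    obtain v2 where v2: "v = Down # v2"
      using fits_top[of h v] 2 True by auto
    obtain w2 where w2: "w' = Down # w2"
      using fits_top[of h w'] 2 True w by auto
    have eq: "a 0 = b 0 \<and> grow h (Suc c) (a \<circ> Suc) v = grow h (Suc c) (b \<circ> Suc) w'"
      using 2(4) True unfolding w v2 w2 by (auto dest: zigzag_append_eqD)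
    have "v = w' \<and> (\<forall>q<rises h (Suc c) v. (a \<circ> Suc) q = (b \<circ> Suc) q)"
      by (rule "2.IH"[OF _ _ conjunct2[OF eq]]) (use 2 w in auto)
    then show ?thesis
      using eq w True by (auto simp: less_Suc_eq_0_disj)
  next
    case False
    then show ?thesis using 2 w by auto
  qed
next
  case (3 h c v)
  have "grow h c b w \<noteq> [] \<and> hd (grow h c b w) = Down"
    unfolding 3(4)[symmetric] by simp
  then have "w \<noteq> []" "hd w = Down"
    using grow_eq_Nil_iff[of h c b w] hd_grow[of w h c b] by auto
  then obtain w' where w: "w = Down # w'" by (cases w) auto
  then show ?case using 3 by auto
qed

text \<open>
  Together with \<open>fits\<close> and a positive number of rises this pins down the level \<open>h\<close> of a path.
\<close>

lemma rises_above: "fits h c w \<Longrightarrow> h < h' \<Longrightarrow> rises h' c w = 0"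
  by (induction h c w rule: fits.induct) auto

section \<open>Reading off a partition from a Dyck path\<close>

text \<open>
  A path starting with an up step is cut before each of its up steps. The list contains the
  numbers of down steps in the pieces; for \<open>P(\<lambda>)\<close> these are the differences of \<open>\<lambda>\<close> from the last
  row to the first, and then \<open>l + 1 - \<lambda>\<^sub>1\<close>.
\<close>

definition blocks :: "nat list \<Rightarrow> step list" where
  "blocks cs = concat (map (\<lambda>c. Up # replicate c Down) cs)"

lemma blocks_simps [simp]:
  "blocks [] = []" "blocks (c # cs) = Up # replicate c Down @ blocks cs"
  by (simp_all add: blocks_def)

lemma P_path_eq_blocks:
  "P_path l lam = blocks (map (\<lambda>i. lam i - lam (i + 1)) (rev [1..<l + 1]) @ [l + 1 - lam 1])"
  by (simp add: P_path_def blocks_def comp_def)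

lemma word_eq_blocks: "\<exists>c cs. w = replicate c Down @ blocks cs"
proof (induction w)
  case Nil
  have "[] = replicate 0 Down @ blocks []" by simp
  then show ?case by blast
next
  case (Cons x w)
  then obtain c cs where w: "w = replicate c Down @ blocks cs" by blast
  show ?case
  proof (cases x)
    case Up
    then have "x # w = replicate 0 Down @ blocks (c # cs)" using w by simp
    then show ?thesis by blast
  next
    case Down
    then have "x # w = replicate (Suc c) Down @ blocks cs" using w by simp
    then show ?thesis by blast
  qed
qed

lemma fits_replicate_Down:
  "fits h c (replicate d Down @ w) \<Longrightarrow> d \<le> c \<and> fits h (c - d) w"
proof (induction d arbitrary: c)
  case (Suc d)
  then show ?case by fastforce
qed simp

text \<open>
  That a path does not go below zero, tested just before each of its up steps, is the condition
  \<open>\<lambda>\<^sub>i \<le> l + 1 - i\<close> for the partial sums of the list.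
\<close>

lemma fits_blocks:
  "fits h c (blocks cs) \<Longrightarrow>
   sum_list cs = c + length cs \<and> (\<forall>m\<le>length cs. sum_list (take m cs) \<le> c + m)"
proof (induction cs arbitrary: c)
  case (Cons d cs)
  then have d: "d \<le> Suc c" "fits h (Suc c - d) (blocks cs)"
    using fits_replicate_Down[of h "Suc c" d "blocks cs"] by auto
  have IH: "sum_list cs = Suc c - d + length cs"
    "\<And>m. m \<le> length cs \<Longrightarrow> sum_list (take m cs) \<le> Suc c - d + m"
    using Cons.IH[OF d(2)] by auto
  have "sum_list (take m (d # cs)) \<le> c + m" if "m \<le> length (d # cs)" for m
  proof (cases m)
    case (Suc n)
    then show ?thesis using IH(2)[of n] that d by auto
  qed simp
  then show ?case using IH d by auto
qed simp

lemma length_blocks: "length (blocks cs) = length cs + sum_list cs"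
  by (induction cs) auto

lemma hd_blocks: "blocks cs \<noteq> [] \<Longrightarrow> hd (blocks cs) = Up"
  by (cases cs) auto

lemma num_peaks_replicate_Down: "num_peaks (replicate c Down @ w) = num_peaks w"
  by (induction c) auto

lemma num_peaks_blocks: "num_peaks (blocks cs) = length (filter (\<lambda>c. 0 < c) cs)"
proof (induction cs)
  case (Cons c cs)
  then show ?case
    by (cases c) (auto simp: num_peaks_replicate_Down hd_blocks)
qed simp

text \<open>
  Each corner is a positive difference and thus a peak; the last block is a peak because
  \<open>\<lambda>\<^sub>1 \<le> l\<close>.
\<close>

lemma num_peaks_P_path:
  assumes "lam \<in> partitions l"
  shows "num_peaks (P_path l lam) = Suc (card (corners l lam))"
proof -
  have "length (filter (\<lambda>c. 0 < c) (map (\<lambda>i. lam i - lam (i + 1)) (rev [1..<l + 1])))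
      = length (filter (\<lambda>i. lam (i + 1) < lam i) [1..<l + 1])"
    by (simp add: filter_map comp_def rev_filter[symmetric])
  also have "\<dots> = card {i \<in> set [1..<l + 1]. lam (i + 1) < lam i}"
    by (subst distinct_card[symmetric]) (auto simp: Collect_conj_eq Int_commute)
  also have "\<dots> = card (corners l lam)"
    by (rule arg_cong[of _ _ card]) (auto simp: corners_def)
  finally show ?thesis
    using partition_le[OF assms, of 1] by (simp add: P_path_eq_blocks num_peaks_blocks)
qed

text \<open>
  The partition is read off as the partial sums of the numbers of down steps.
\<close>

lemma P_path_surj:
  assumes "fits h 0 w" "length w = 2 * (l + 1)"
  shows "w \<in> P_path l ` partitions l"
proof -
  obtain c cs where "w = replicate c Down @ blocks cs" using word_eq_blocks by blast
  then have w: "w = blocks cs"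
    using fits_replicate_Down[of h 0 c "blocks cs"] assms(1) by simp
  have sum: "sum_list cs = length cs" and pre: "\<And>m. m \<le> length cs \<Longrightarrow> sum_list (take m cs) \<le> m"
    using fits_blocks[of h 0 cs] assms(1) w by auto
  have len: "length cs = l + 1"
    using assms(2) w sum by (simp add: length_blocks)
  \<comment> \<open>Block number \<open>m\<close>, counted from \<open>0\<close>, belongs to row \<open>l - m\<close>.\<close>
  define lam where "lam i = (if i \<in> {1..l} then sum_list (take (l + 1 - i) cs) else 0)" for i
  have lam_eq: "lam i = sum_list (take (l + 1 - i) cs)" if "1 \<le> i" for i
    using that by (auto simp: lam_def)
  have step: "lam i = lam (i + 1) + cs ! (l - i)" if "1 \<le> i" "i \<le> l" for i
  proof -
    have "l + 1 - i = Suc (l - i)" using that by auto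
    then have "take (l + 1 - i) cs = take (l - i) cs @ [cs ! (l - i)]"
      using len by (simp add: take_Suc_conv_app_nth)
    then show ?thesis using lam_eq[of i] lam_eq[of "i + 1"] that by simp
  qed
  have partition: "lam \<in> partitions l"
    unfolding partitions_def
  proof (intro CollectI conjI allI ballI impI)
    fix i assume "1 \<le> i \<and> i < l"
    then show "lam (i + 1) \<le> lam i" using step[of i] by simp
  next
    fix i assume "i \<in> {1..l}"
    then show "lam i \<le> l + 1 - i" using lam_eq[of i] pre[of "l + 1 - i"] len by simp
  qed (auto simp: lam_def)
  have "map (\<lambda>i. lam i - lam (i + 1)) (rev [1..<l + 1]) @ [l + 1 - lam 1] = cs"
  proof (rule nth_equalityI)
    fix m assume "m < length (map (\<lambda>i. lam i - lam (i + 1)) (rev [1..<l + 1]) @ [l + 1 - lam 1])"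
    then have "m < Suc l" by (simp del: upt_Suc)
    then consider "m < l" | "m = l" by linarith
    then show "(map (\<lambda>i. lam i - lam (i + 1)) (rev [1..<l + 1]) @ [l + 1 - lam 1]) ! m = cs ! m"
    proof cases
      case 1
      then have "rev [1..<l + 1] ! m = l - m" by (simp add: rev_nth del: upt_Suc)
      then show ?thesis using 1 step[of "l - m"] by (simp add: nth_append del: upt_Suc)
    next
      case 2
      have "cs = take l cs @ [cs ! l]"
        using len by (metis Suc_eq_plus1 lessI take_Suc_conv_app_nth take_all order_refl)
      then have "sum_list cs = lam 1 + cs ! l"
        using lam_eq[of 1] by (metis One_nat_def add_diff_cancel_right' le_refl sum_list.Cons
            sum_list.Nil sum_list_append add.right_neutral)
      then have "l + 1 - lam 1 = cs ! l" using sum len by simp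
      then show ?thesis using 2 by (simp add: nth_append del: upt_Suc)
    qed
  qed (use len in simp)
  then have "P_path l lam = w" unfolding w P_path_eq_blocks by (rule arg_cong)
  then show ?thesis using partition by blast
qed

section \<open>The stages of the construction of the path of a partition\<close>

text \<open>
  \<open>level_index l \<lambda> r\<close> is the number \<open>i\<^sub>k\<^sub>+\<^sub>1\<^sub>-\<^sub>r\<close>. Counting from the top and starting with
  \<open>i\<^sub>k\<^sub>+\<^sub>1 = l + 1\<close> makes the recursion uniform, because \<open>\<lambda>\<^sub>1\<close> is the part with index
  \<open>l + 2 - (l + 1)\<close>. In the forest of \<open>D\<^sub>\<lambda>\<close>, \<open>level_index l \<lambda> r\<close> is the number of nodes of depth
  greater than \<open>r\<close>, where the roots have depth \<open>1\<close>.
\<close>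

definition level_index :: "nat \<Rightarrow> (nat \<Rightarrow> nat) \<Rightarrow> nat \<Rightarrow> nat" where
  "level_index l lam r = (case r of 0 \<Rightarrow> l + 1 | Suc s \<Rightarrow> descent l lam s)"

lemma level_index_0 [simp]: "level_index l lam 0 = l + 1"
  by (simp add: level_index_def)

lemma level_index_Suc: "level_index l lam (Suc r) = lam (l + 2 - level_index l lam r)"
  by (cases r) (simp_all add: level_index_def)

lemma level_index_le: "lam \<in> partitions l \<Longrightarrow> level_index l lam r \<le> l + 1"
proof (induction r)
  case (Suc r)
  then have "1 \<le> l + 2 - level_index l lam r" by simp
  then show ?case
    using partition_le[OF Suc.prems, of "l + 2 - level_index l lam r"] level_index_Suc[of l lam r]
    by linarith
qed simp

text \<open>
  The part with index \<open>l + 2 - e\<close> is at most \<open>e - 1\<close>, because the diagram lies in the staircase.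
\<close>

lemma level_index_decreasing:
  assumes "lam \<in> partitions l" "0 < level_index l lam r"
  shows "level_index l lam (Suc r) < level_index l lam r"
proof -
  have "level_index l lam r \<le> l + 1" using assms(1) by (rule level_index_le)
  moreover from this have "1 \<le> l + 2 - level_index l lam r" by simp
  ultimately show ?thesis
    using partition_le[OF assms(1), of "l + 2 - level_index l lam r"] level_index_Suc[of l lam r]
      assms(2) by linarith
qed

lemma descent_num_desc:
  assumes "lam \<in> partitions l"
  shows "descent l lam (num_desc l lam) = 0"
proof -
  have "\<exists>r. descent l lam r = 0"
  proof (rule ccontr)
    assume "\<not> ?thesis"
    then have pos: "0 < level_index l lam r" for r
      by (cases r) (auto simp: level_index_def)
    have "level_index l lam r + r \<le> l + 1" for r
    proof (induction r)
      case (Suc r)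
      then show ?case using level_index_decreasing[OF assms pos, of r] by simp
    qed simp
    from this[of "l + 1"] pos[of "l + 1"] show False by simp
  qed
  then show ?thesis unfolding num_desc_def by (rule LeastI_ex)
qed

lemma level_index_pos: "r \<le> num_desc l lam \<Longrightarrow> 0 < level_index l lam r"
  using not_less_Least[of _ "\<lambda>r. descent l lam r = 0"]
  by (cases r) (auto simp: level_index_def num_desc_def)

lemma ins_num_eq:
  assumes "r < num_desc l lam"
  shows "ins_num l lam (num_desc l lam - r) q =
    (if q < level_index l lam r - level_index l lam (Suc r)
     then lam (l + 2 - level_index l lam r + q) - lam (l + 3 - level_index l lam r + q) else 0)"
proof -
  let ?k = "num_desc l lam"
  have "idx l lam (?k - r + 1) = level_index l lam r"
    using assms by (cases r) (auto simp: idx_def level_index_def Suc_diff_Suc)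
  moreover have "idx l lam (?k - r) = level_index l lam (Suc r)"
    using assms by (auto simp: idx_def level_index_def)
  ultimately show ?thesis by (simp add: ins_num_def)
qed

lemma idx_num_desc:
  assumes "lam \<in> partitions l"
  shows "idx l lam (num_desc l lam) = lam 1"
  using descent_num_desc[OF assms] by (auto simp: idx_def)

lemma sum_partition_differences:
  assumes "lam \<in> partitions l" "1 \<le> m"
  shows "(\<Sum>q<n. lam (m + q) - lam (Suc (m + q))) = lam m - lam (m + n)"
proof (induction n)
  case (Suc n)
  have "lam (m + n) \<le> lam m" "lam (Suc (m + n)) \<le> lam (m + n)"
    using partition_antimono[OF assms, of "m + n"]
      partition_antimono[OF assms(1), of "m + n" "Suc (m + n)"] assms(2) by auto
  then show ?case using Suc by simp
qed simp

lemma zigzag_facts: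
  "fits (Suc 0) 0 (zigzag p)" "rises (Suc 0) 0 (zigzag p) = p" "num_peaks (zigzag p) = p"
  by (induction p) auto

text \<open>
  At stage \<open>r\<close> the forest has the levels \<open>1, \<dots>, r + 1\<close>, of which the deepest has
  \<open>level_index l \<lambda> r - level_index l \<lambda> (r + 1)\<close> nodes, and the child numbers used so far are the
  differences of the rows \<open>1, \<dots>, l + 1 - level_index l \<lambda> r\<close>. The next block of rows has one row
  for each of these nodes, and its differences telescope to the size of the next level.
\<close>

lemma D_stage_invariant:
  assumes lam: "lam \<in> partitions l"
  shows "r \<le> num_desc l lam \<Longrightarrow>
    fits (Suc r) 0 (D_stage l lam r) \<and>
    rises (Suc r) 0 (D_stage l lam r) = level_index l lam r - level_index l lam (Suc r) \<and>
    length (D_stage l lam r) = 2 * (l + 1 - level_index l lam (Suc r)) \<and>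
    num_peaks (D_stage l lam r) = l + 1 - lam 1 +
      (\<Sum>i\<in>{1..<l + 2 - level_index l lam r}. lam i - lam (Suc i) - 1)"
proof (induction r)
  case 0
  then show ?case
    by (simp add: idx_num_desc[OF lam] zigzag_facts length_zigzag level_index_Suc)
next
  case (Suc r)
  let ?e = "level_index l lam" and ?w = "D_stage l lam r"
  let ?a = "ins_num l lam (num_desc l lam - r)"
  have r: "r < num_desc l lam" using Suc.prems by simp
  have IH: "fits (Suc r) 0 ?w" "rises (Suc r) 0 ?w = ?e r - ?e (Suc r)"
    "length ?w = 2 * (l + 1 - ?e (Suc r))"
    "num_peaks ?w = l + 1 - lam 1 + (\<Sum>i\<in>{1..<l + 2 - ?e r}. lam i - lam (Suc i) - 1)"
    using Suc by auto
  have dec: "?e (Suc r) < ?e r" "?e (Suc (Suc r)) < ?e (Suc r)" and le: "?e r \<le> l + 1"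
    using level_index_decreasing[OF lam] level_index_pos[of _ l lam] r level_index_le[OF lam]
    by auto
  have D: "D_stage l lam (Suc r) = grow (Suc r) 0 ?a ?w"
    using IH dec insert_peaks_eq_grow[of "Suc r" ?w ?a] by simp
  \<comment> \<open>The rows \<open>m, \<dots>, m + n - 1\<close> give the child numbers of the \<open>n\<close> nodes of the deepest level.\<close>
  define m where "m = l + 2 - ?e r"
  define n where "n = ?e r - ?e (Suc r)"
  have m: "1 \<le> m" "m + n = l + 2 - ?e (Suc r)" using dec le by (auto simp: m_def n_def)
  have a: "?a q = lam (m + q) - lam (Suc (m + q))" if "q < n" for q
    using ins_num_eq[OF r, of q] that le by (simp add: m_def n_def Suc_diff_le numeral_3_eq_3)
  have sum: "(\<Sum>q<n. ?a q) = ?e (Suc r) - ?e (Suc (Suc r))"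
  proof -
    have "(\<Sum>q<n. ?a q) = lam m - lam (m + n)"
      using a sum_partition_differences[OF lam m(1), of n] by simp
    also have "\<dots> = ?e (Suc r) - ?e (Suc (Suc r))"
      by (simp add: m(2) level_index_Suc) (simp add: m_def)
    finally show ?thesis .
  qed
  have "(\<Sum>q<n. ?a q - 1) = (\<Sum>q<n. lam (m + q) - lam (Suc (m + q)) - 1)"
    using a by (intro sum.cong) auto
  also have "\<dots> = (\<Sum>i\<in>{m..<m + n}. lam i - lam (Suc i) - 1)"
    using sum.shift_bounds_nat_ivl[of "\<lambda>i. lam i - lam (Suc i) - 1" 0 m n]
    by (simp add: atLeast0LessThan add.commute)
  finally have "(\<Sum>i\<in>{1..<m}. lam i - lam (Suc i) - 1) + (\<Sum>q<n. ?a q - 1)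
      = (\<Sum>i\<in>{1..<m + n}. lam i - lam (Suc i) - 1)"
    using m by (simp add: sum.atLeastLessThan_concat)
  moreover have "num_peaks (grow (Suc r) 0 ?a ?w) = num_peaks ?w + (\<Sum>q<n. ?a q - 1)"
    using num_peaks_grow[OF IH(1), of ?a] IH(2) by (simp add: n_def)
  ultimately have peaks: "num_peaks (grow (Suc r) 0 ?a ?w) =
      l + 1 - lam 1 + (\<Sum>i\<in>{1..<m + n}. lam i - lam (Suc i) - 1)"
    using IH(4) by (simp add: m_def)
  have "fits (Suc (Suc r)) 0 (grow (Suc r) 0 ?a ?w)"
    using IH by (intro fits_grow)
  moreover have "rises (Suc (Suc r)) 0 (grow (Suc r) 0 ?a ?w) = ?e (Suc r) - ?e (Suc (Suc r))"
    using rises_grow[OF IH(1), of ?a] IH(2) sum by (simp add: n_def)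
  moreover have "length (grow (Suc r) 0 ?a ?w) = 2 * (l + 1 - ?e (Suc (Suc r)))"
  proof -
    have "(l + 1 - ?e (Suc r)) + (?e (Suc r) - ?e (Suc (Suc r))) = l + 1 - ?e (Suc (Suc r))"
      using dec le by linarith
    then show ?thesis
      using length_grow[of "Suc r" 0 ?a ?w] IH(2,3) sum
      by (metis n_def add_mult_distrib2)
  qed
  ultimately show ?case
    unfolding D using peaks m(2) by simp
qed

lemma D_stage_Suc_eq_grow:
  assumes "lam \<in> partitions l" "r < num_desc l lam"
  shows "D_stage l lam (Suc r) =
    grow (Suc r) 0 (ins_num l lam (num_desc l lam - r)) (D_stage l lam r)"
  using D_stage_invariant[OF assms(1), of r] level_index_decreasing[OF assms(1), of r]
    level_index_pos[of r l lam] assms(2) by (simp add: insert_peaks_eq_grow)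

text \<open>
  After the last stage no row with a positive part is left, so the sum of the truncated
  differences \<open>\<lambda>\<^sub>i - \<lambda>\<^sub>i\<^sub>+\<^sub>1 - 1\<close> extends over all rows. Adding one for each corner restores the plain
  differences, with sum \<open>\<lambda>\<^sub>1\<close>; and there were \<open>l + 1 - \<lambda>\<^sub>1\<close> peaks at the beginning.
\<close>

lemma D_path_facts:
  assumes lam: "lam \<in> partitions l"
  defines "k \<equiv> num_desc l lam"
  shows "fits (Suc k) 0 (D_path l lam)" "0 < rises (Suc k) 0 (D_path l lam)"
    "length (D_path l lam) = 2 * (l + 1)"
    "num_peaks (D_path l lam) + card (corners l lam) = l + 1"
proof -
  let ?g = "\<lambda>i. lam i - lam (Suc i) - 1"
  have last: "level_index l lam (Suc k) = 0"
    using descent_num_desc[OF lam] by (simp add: level_index_def k_def)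
  have pos: "0 < level_index l lam k" using level_index_pos by (simp add: k_def)
  have inv: "fits (Suc k) 0 (D_path l lam)"
    "rises (Suc k) 0 (D_path l lam) = level_index l lam k"
    "length (D_path l lam) = 2 * (l + 1)"
    "num_peaks (D_path l lam) = l + 1 - lam 1 + sum ?g {1..<l + 2 - level_index l lam k}"
    using D_stage_invariant[OF lam, of k] last by (auto simp: D_path_def k_def)
  show "fits (Suc k) 0 (D_path l lam)" "0 < rises (Suc k) 0 (D_path l lam)"
    "length (D_path l lam) = 2 * (l + 1)"
    using inv pos by auto
  \<comment> \<open>The recursion ends with \<open>lam (l + 2 - level_index l lam k) = 0\<close>, and later parts are at most as large.\<close>
  have zero: "lam i = 0" if "l + 2 - level_index l lam k \<le> i" for i
    using partition_antimono[OF lam _ that] last level_index_le[OF lam, of k]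
    by (simp add: level_index_Suc)
  have "sum ?g {1..<l + 2 - level_index l lam k} = sum ?g {1..<l + 1}"
    by (rule sum.mono_neutral_left) (use pos zero in auto)
  then have peaks: "num_peaks (D_path l lam) = l + 1 - lam 1 + sum ?g {1..<l + 1}"
    using inv by simp
  have "corners l lam = {i \<in> {1..<l + 1}. lam (Suc i) < lam i}" by (auto simp: corners_def)
  then have "card (corners l lam) = (\<Sum>i\<in>{1..<l + 1}. if lam (Suc i) < lam i then 1 else 0)"
    by (simp only: card_eq_sum sum.inter_filter[OF finite_atLeastLessThan])
  then have "sum ?g {1..<l + 1} + card (corners l lam)
      = (\<Sum>i\<in>{1..<l + 1}. ?g i + (if lam (Suc i) < lam i then 1 else 0))"
    by (simp only: sum.distrib)
  also have "\<dots> = (\<Sum>i\<in>{1..<l + 1}. lam i - lam (Suc i))"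
    by (rule sum.cong) auto
  also have "\<dots> = lam 1"
    using sum_partition_differences[OF lam, of 1 l] partition_outside[OF lam, of "l + 1"]
      sum.shift_bounds_nat_ivl[of "\<lambda>i. lam i - lam (Suc i)" 0 1 l]
    by (simp add: atLeast0LessThan)
  finally show "num_peaks (D_path l lam) + card (corners l lam) = l + 1"
    using peaks partition_le[OF lam, of 1] by simp
qed

text \<open>
  Going back from stage \<open>r + 1\<close> to stage \<open>r\<close> recovers one block of differences. The rows up to the
  first one of the block are known by induction, so the differences give the further rows of the
  block, and the next index \<open>i\<^sub>j\<close> is one of the parts already known.
\<close>

lemma D_stage_inject:
  assumes lam: "lam \<in> partitions l" and mu: "mu \<in> partitions l"
    and k: "num_desc l lam = k" "num_desc l mu = k"
  shows "r \<le> k \<Longrightarrow> D_stage l lam r = D_stage l mu r \<Longrightarrow>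
    level_index l lam r = level_index l mu r \<and>
    (\<forall>i. 1 \<le> i \<longrightarrow> i \<le> l + 2 - level_index l lam r \<longrightarrow> lam i = mu i)"
proof (induction r)
  case 0
  have "2 * (l + 1 - lam 1) = 2 * (l + 1 - mu 1)"
    using arg_cong[OF 0(2), of length] idx_num_desc[OF lam] idx_num_desc[OF mu]
    by (simp add: length_zigzag)
  then have "lam 1 = mu 1"
    using partition_le[OF lam, of 1] partition_le[OF mu, of 1] by simp
  then show ?case by (auto simp: le_Suc_eq)
next
  case (Suc r)
  let ?e = "level_index l lam"
  have r: "r < num_desc l lam" "r < num_desc l mu" using Suc k by auto
  have fits: "fits (Suc r) 0 (D_stage l lam r)" "fits (Suc r) 0 (D_stage l mu r)"
    and rises: "rises (Suc r) 0 (D_stage l lam r) = ?e r - ?e (Suc r)"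
    using D_stage_invariant[OF lam, of r] D_stage_invariant[OF mu, of r] r by auto
  have "D_stage l lam r = D_stage l mu r \<and>
    (\<forall>q<?e r - ?e (Suc r). ins_num l lam (k - r) q = ins_num l mu (k - r) q)"
    using grow_inject[OF fits] Suc.prems(2) rises k
    unfolding D_stage_Suc_eq_grow[OF lam r(1)] D_stage_Suc_eq_grow[OF mu r(2)] by auto
  then have st: "D_stage l lam r = D_stage l mu r"
    and a: "\<And>q. q < ?e r - ?e (Suc r) \<Longrightarrow> ins_num l lam (k - r) q = ins_num l mu (k - r) q"
    by auto
  have e: "?e r = level_index l mu r"
    and agree: "\<And>i. 1 \<le> i \<Longrightarrow> i \<le> l + 2 - ?e r \<Longrightarrow> lam i = mu i"
    using Suc.IH st Suc.prems by auto
  have le: "?e r \<le> l + 1" "?e (Suc r) < ?e r"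
    using level_index_le[OF lam] level_index_decreasing[OF lam] level_index_pos[of r l lam] r by auto
  have e': "?e (Suc r) = level_index l mu (Suc r)"
    using agree[of "l + 2 - ?e r"] e le by (simp add: level_index_Suc)
  have "lam (l + 2 - ?e r + q) = mu (l + 2 - ?e r + q)" if "q \<le> ?e r - ?e (Suc r)" for q
    using that
  proof (induction q)
    case 0
    then show ?case using agree[of "l + 2 - ?e r"] le by simp
  next
    case (Suc q)
    define i where "i = l + 2 - ?e r + q"
    have i: "l + 3 - ?e r + q = Suc i" using le by (simp add: i_def)
    have "lam i - lam (Suc i) = mu i - mu (Suc i)"
      using a[of q] ins_num_eq[OF r(1), of q] ins_num_eq[OF r(2), of q] Suc.prems k e e' i
      by (simp add: i_def)
    moreover have "lam i = mu i" using Suc by (simp add: i_def)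
    moreover have "lam (Suc i) \<le> lam i" "mu (Suc i) \<le> mu i"
      using partition_antimono[OF lam, of i "Suc i"] partition_antimono[OF mu, of i "Suc i"] le
      by (auto simp: i_def)
    ultimately have "lam (Suc i) = mu (Suc i)" by linarith
    then show ?case by (simp add: i_def)
  qed
  note block = this
  have "lam i = mu i" if "1 \<le> i" "i \<le> l + 2 - ?e (Suc r)" for i
  proof (cases "i \<le> l + 2 - ?e r")
    case False
    then show ?thesis using block[of "i - (l + 2 - ?e r)"] that le by simp
  qed (use agree that in auto)
  then show ?case using e' by blast
qed

text \<open>
  The maximal height of \<open>D\<^sub>\<lambda>\<close> is one more than the number of stages, so equal paths arise in
  equally many stages and can be compared stage by stage.
\<close>

lemma inj_on_D_path: "inj_on (D_path l) (partitions l)"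
proof (rule inj_onI)
  fix lam mu
  assume lam: "lam \<in> partitions l" and mu: "mu \<in> partitions l" and eq: "D_path l lam = D_path l mu"
  have k: "num_desc l lam = num_desc l mu"
  proof (rule ccontr)
    assume "num_desc l lam \<noteq> num_desc l mu"
    then show False
      using D_path_facts(1,2)[OF lam] D_path_facts(1,2)[OF mu] eq
      by (metis Suc_less_eq linorder_neqE_nat rises_above less_nat_zero_code)
  qed
  let ?k = "num_desc l mu" and ?m = "l + 2 - level_index l lam (num_desc l mu)"
  have inj: "level_index l lam ?k = level_index l mu ?k"
    "\<And>i. 1 \<le> i \<Longrightarrow> i \<le> ?m \<Longrightarrow> lam i = mu i"
    using D_stage_inject[OF lam mu k refl order_refl] eq k by (auto simp: D_path_def)
  have "lam ?m = 0" "mu ?m = 0"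
    using descent_num_desc[OF lam] descent_num_desc[OF mu] k inj(1)
      level_index_Suc[of l lam ?k] level_index_Suc[of l mu ?k]
    by (auto simp: level_index_def)
  then have zero: "lam i = 0" "mu i = 0" if "?m \<le> i" for i
    using partition_antimono[OF lam _ that] partition_antimono[OF mu _ that]
      level_index_le[OF lam, of ?k] by auto
  show "lam = mu"
  proof
    fix i
    consider "i = 0" | "1 \<le> i" "i \<le> ?m" | "?m \<le> i" by linarith
    then show "lam i = mu i"
      using inj(2) zero partition_outside[OF lam] partition_outside[OF mu] by cases auto
  qed
qed

theorem theorem6p3:
  fixes l :: nat
  assumes "l \<ge> 1"
  shows "let f = inv_into (root_ideals l) (sigma l) \<circ> inv_into (partitions l) (P_path l)
                   \<circ> D_path l \<circ> sigma l
         in bij_betw f (root_ideals l) (root_ideals l) \<and>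
            (\<forall>p. \<forall>\<Phi>\<in>root_ideals l. card (min_roots l \<Phi>) = p \<longrightarrow>
               int (card (min_roots l (f \<Phi>))) = int l - int p)"
proof -
  let ?R = "root_ideals l" and ?Q = "partitions l"
  define g where "g = inv_into ?Q (P_path l) \<circ> D_path l"
  define f where "f = inv_into ?R (sigma l) \<circ> inv_into ?Q (P_path l) \<circ> D_path l \<circ> sigma l"
  have f: "f \<Phi> = inv_into ?R (sigma l) (g (sigma l \<Phi>))" for \<Phi>
    by (simp add: f_def g_def)
  have D: "D_path l lam \<in> P_path l ` ?Q" if "lam \<in> ?Q" for lam
    using P_path_surj D_path_facts(1,3)[OF that] by blast
  have g: "g lam \<in> ?Q" "P_path l (g lam) = D_path l lam" if "lam \<in> ?Q" for lam
    using D[OF that] by (auto simp: g_def inv_into_into f_inv_into_f)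
  have sigma_f: "f \<Phi> \<in> ?R \<and> sigma l (f \<Phi>) = g (sigma l \<Phi>)" if "\<Phi> \<in> ?R" for \<Phi>
  proof -
    have "g (sigma l \<Phi>) \<in> sigma l ` ?R"
      using g(1) sigma_in_partitions[OF that] partitions_subset_sigma_image by blast
    then show ?thesis by (simp add: f inv_into_into f_inv_into_f)
  qed
  have "inj_on f ?R"
  proof (rule inj_onI)
    fix \<Phi> \<Psi> assume \<Phi>: "\<Phi> \<in> ?R" and \<Psi>: "\<Psi> \<in> ?R" and "f \<Phi> = f \<Psi>"
    then have "g (sigma l \<Phi>) = g (sigma l \<Psi>)" using sigma_f by metis
    then have "D_path l (sigma l \<Phi>) = D_path l (sigma l \<Psi>)"
      using g(2) sigma_in_partitions \<Phi> \<Psi> by metis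
    then have "sigma l \<Phi> = sigma l \<Psi>"
      using inj_on_D_path sigma_in_partitions \<Phi> \<Psi> by (metis inj_onD)
    then show "\<Phi> = \<Psi>" using inj_on_sigma \<Phi> \<Psi> by (metis inj_onD)
  qed
  moreover have "f ` ?R = ?R"
    using endo_inj_surj[OF finite_root_ideals] calculation sigma_f by blast
  ultimately have bij: "bij_betw f ?R ?R" by (simp add: bij_betw_def)
  have "int (card (min_roots l (f \<Phi>))) = int l - int (card (min_roots l \<Phi>))" if "\<Phi> \<in> ?R" for \<Phi>
  proof -
    let ?lam = "sigma l \<Phi>"
    have lam: "?lam \<in> ?Q" using that by (rule sigma_in_partitions)
    have "Suc (card (corners l (g ?lam))) + card (corners l ?lam) = l + 1"
      using num_peaks_P_path[OF g(1)[OF lam]] g(2)[OF lam] D_path_facts(4)[OF lam] by simp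
    then show ?thesis using sigma_f[OF that] that by (simp add: card_min_roots)
  qed
  then show ?thesis using bij by (simp add: Let_def f_def)
qed

end
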